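(* (Distance-reducing path lemma.) Consider a simple augmented configuration on the $m\times 5$ grid and an integer $t\ge0$. Let $s_0,\ldots,s_{t+1}$ be distinct rows and let $a,b,c$ be distinct columns. Suppose that for each $0\le j\le t$ the cells $\{(s_j,a),(s_{j+1},b)\}$ form a selected two-edge which is resolved (i.e. $\langle v_{s_j,a},v_{s_{j+1},b}\rangle=1$ is certified), and let $E_j$ denote the representative unit vector of this resolved pair. Let $Y_i=v_{s_i,c}$ be the cell vector at $(s_i,c)$ for $0\le i\le t+1$. Then $$Y_i\perp_R E_j\qquad\text{for all } 0\le i\le t+1 \text{ and } 0\le j\le t,$$ i.e. $\langle Y_i,E_j\rangle=0$ is certified.
   Context: **Augmented configurations.** Cells of the $m\times5$ grid are pairs $(r,c)$, $1\le r\le m$, $1\le c\le5$. An augmented configuration consists of a set $E_1$ of cells (one-edges) and a set $E_2$ of unordered pairs of distinct cells (selected two-edges; the two cells are the halves of the two-edge). Each cell contains at most one edge element, i.e. it is a one-edge, or one half of exactly one selected two-edge, or unoccupied (a hole). The configuration is simple if supports of distinct edge elements are disjoint in this sense and the bipartite graph between rows and columns with edge set $E_1$ is $C_4$-free. **Certificates.** To each occupied cell $p$ associate a formal unit vector $v_p$, and put $v_p=0$ for unoccupied $p$. For distinct cells $p,q$ let $\delta(p,q)=1$ if $\{p,q\}\in E_2$ and $\delta(p,q)=0$ otherwise. The certified relations are the statements $\langle v_p,v_q\rangle=\text{(value)}$ (symmetric in $p,q$) obtainable in finitely many steps by: - Unit/hole: $\langle v_p,v_p\rangle=1$ for occupied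 $p$; $\langle v_p,v_q\rangle=0$ if $p$ or $q$ is unoccupied. - Line rule: if $p\ne q$ lie in a common row or a common column, then $\langle v_p,v_q\rangle=\delta(p,q)$. - Rectangle rule: for distinct rows and distinct columns forming a genuine $2\times2$ rectangle with diagonals $\{p,q\}$ and $\{r,s\}$, one has $\langle v_p,v_q\rangle+\langle v_r,v_s\rangle=\delta(p,q)+\delta(r,s)$; so if the value of one diagonal is certified, the value of the other one given by this identity is certified. - Complementary-pair rule: if both diagonals of a genuine rectangle are selected two-edges, then both diagonals are certified to have value $1$. - Saturation: if $\langle v_p,v_{p'}\rangle=1$ is certified, then $p$ and $p'$ may be interchanged in any certified relation. $p\perp_R q$ means that $\langle v_p,v_q\rangle=0$ is certified. A selected two-edge $\{p,q\}$ is resolved if $\langle v_p,v_q\rangle=1$ is certified; then $v_p,v_q$ are identified with a single representative unit vector, and a relation about this vector may be read at either half. *)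

theory Defs
  imports Complex_Main
begin

type_synonym cell = "nat \<times> nat"

definition grid :: "nat \<Rightarrow> cell set" where
  "grid m = {1..m} \<times> {1..5}"

text \<open>Edge elements are represented by their supports: a one-edge \<open>p \<in> E1\<close> by \<open>{p}\<close>, a
  two-edge by the set of its two halves. Two-edges have two distinct halves, so distinct edge
  elements have distinct representatives.\<close>

definition edge_elements :: "cell set \<Rightarrow> cell set set \<Rightarrow> cell set set" where
  "edge_elements E1 E2 = (\<lambda>p. {p}) ` E1 \<union> E2"

definition occupied :: "cell set \<Rightarrow> cell set set \<Rightarrow> cell \<Rightarrow> bool" where
  "occupied E1 E2 p \<longleftrightarrow> (\<exists>S \<in> edge_elements E1 E2. p \<in> S)"

definition augmented_configuration :: "nat \<Rightarrow> cell set \<Rightarrow> cell set set \<Rightarrow> bool" where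
  "augmented_configuration m E1 E2 \<longleftrightarrow>
     E1 \<subseteq> grid m \<and>
     (\<forall>e \<in> E2. \<exists>p q. p \<in> grid m \<and> q \<in> grid m \<and> p \<noteq> q \<and> e = {p, q}) \<and>
     (\<forall>p \<in> grid m. \<forall>S \<in> edge_elements E1 E2. \<forall>T \<in> edge_elements E1 E2.
        p \<in> S \<longrightarrow> p \<in> T \<longrightarrow> S = T)"

text \<open>The bipartite graph on rows (\<open>Inl\<close>) and columns (\<open>Inr\<close>) whose edges are the given cells.\<close>

definition row_column_graph :: "cell set \<Rightarrow> (nat + nat) set set" where
  "row_column_graph E1 = {{Inl r, Inr c} | r c. (r, c) \<in> E1}"

definition C4_free :: "'v set set \<Rightarrow> bool" where
  "C4_free G \<longleftrightarrow> \<not> (\<exists>w x y z. distinct [w, x, y, z] \<and>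
     {w, x} \<in> G \<and> {x, y} \<in> G \<and> {y, z} \<in> G \<and> {z, w} \<in> G)"

definition simple_configuration :: "nat \<Rightarrow> cell set \<Rightarrow> cell set set \<Rightarrow> bool" where
  "simple_configuration m E1 E2 \<longleftrightarrow>
     augmented_configuration m E1 E2 \<and>
     pairwise disjnt (edge_elements E1 E2) \<and>
     C4_free (row_column_graph E1)"

definition delta :: "cell set set \<Rightarrow> cell \<Rightarrow> cell \<Rightarrow> real" where
  "delta E2 p q = (if p \<noteq> q \<and> {p, q} \<in> E2 then 1 else 0)"

text \<open>\<open>certified m E1 E2 p q x\<close>: the formal relation \<open>\<langle>v\<^sub>p, v\<^sub>q\<rangle> = x\<close> is derivable. All rules speak about
  cells of the grid only; a position outside the grid is not a hole. In the two rectangle rules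
  \<open>c\<close> and \<open>c'\<close> may be exchanged, so each of them covers both diagonals. The rule \<open>saturation\<close>
  together with \<open>sym\<close> gives replacement in either argument.\<close>

inductive certified ::
    "nat \<Rightarrow> cell set \<Rightarrow> cell set set \<Rightarrow> cell \<Rightarrow> cell \<Rightarrow> real \<Rightarrow> bool"
  for m :: nat and E1 :: "cell set" and E2 :: "cell set set" where
  sym: "certified m E1 E2 p q x \<Longrightarrow> certified m E1 E2 q p x"
| unit: "p \<in> grid m \<Longrightarrow> occupied E1 E2 p \<Longrightarrow> certified m E1 E2 p p 1"
| hole: "p \<in> grid m \<Longrightarrow> q \<in> grid m \<Longrightarrow> \<not> occupied E1 E2 p \<or> \<not> occupied E1 E2 q \<Longrightarrow>
    certified m E1 E2 p q 0"
| line: "p \<in> grid m \<Longrightarrow> q \<in> grid m \<Longrightarrow> p \<noteq> q \<Longrightarrow> fst p = fst q \<or> snd p = snd q \<Longrightarrow>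
    certified m E1 E2 p q (delta E2 p q)"
| rectangle: "{r, r'} \<times> {c, c'} \<subseteq> grid m \<Longrightarrow> r \<noteq> r' \<Longrightarrow> c \<noteq> c' \<Longrightarrow>
    certified m E1 E2 (r, c) (r', c') x \<Longrightarrow>
    certified m E1 E2 (r, c') (r', c)
      (delta E2 (r, c) (r', c') + delta E2 (r, c') (r', c) - x)"
| complementary_pair: "{r, r'} \<times> {c, c'} \<subseteq> grid m \<Longrightarrow> r \<noteq> r' \<Longrightarrow> c \<noteq> c' \<Longrightarrow>
    {(r, c), (r', c')} \<in> E2 \<Longrightarrow> {(r, c'), (r', c)} \<in> E2 \<Longrightarrow>
    certified m E1 E2 (r, c) (r', c') 1"
| saturation: "certified m E1 E2 p p' 1 \<Longrightarrow> certified m E1 E2 p q x \<Longrightarrow>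
    certified m E1 E2 p' q x"

definition perp_R :: "nat \<Rightarrow> cell set \<Rightarrow> cell set set \<Rightarrow> cell \<Rightarrow> cell \<Rightarrow> bool" where
  "perp_R m E1 E2 p q \<longleftrightarrow> certified m E1 E2 p q 0"

definition resolved :: "nat \<Rightarrow> cell set \<Rightarrow> cell set set \<Rightarrow> cell \<Rightarrow> cell \<Rightarrow> bool" where
  "resolved m E1 E2 p q \<longleftrightarrow> {p, q} \<in> E2 \<and> certified m E1 E2 p q 1"

text \<open>Orthogonality of \<open>v\<^sub>p\<close> to the representative vector of a resolved two-edge \<open>e\<close>. That vector may
  be read at either half, so the relation is required at both; for a resolved two-edge the two
  requirements are equivalent by saturation.\<close>

definition perp_R_edge :: "nat \<Rightarrow> cell set \<Rightarrow> cell set set \<Rightarrow> cell \<Rightarrow> cell set \<Rightarrow> bool" where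
  "perp_R_edge m E1 E2 p e \<longleftrightarrow> (\<forall>h \<in> e. perp_R m E1 E2 p h)"

end

theory Submission
  imports Defs
begin

text \<open>
  Write \<open>Y\<^sub>i\<close> for the vector of \<open>(s i, c)\<close> and \<open>E\<^sub>j\<close> for the vector shared by the halves
  \<open>(s j, a)\<close> and \<open>(s (j + 1), b)\<close>. The proof is by induction on the distance from \<open>i\<close> to the two
  indices \<open>j\<close>, \<open>j + 1\<close> of the rows in which \<open>E\<^sub>j\<close> has a half.

  A half of \<open>E\<^sub>j\<close> has its only partner in column \<open>a\<close> or \<open>b\<close>, so together with a cell of column \<open>c\<close> it
  never forms a selected two-edge: every \<open>\<delta>\<close> that occurs below is \<open>0\<close>. At distance \<open>0\<close> the cell
  of \<open>Y\<^sub>i\<close> shares a row with a half of \<open>E\<^sub>j\<close>, and the line rule certifies orthogonality. Otherwise a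
  rectangle on column \<open>c\<close> and the column of a suitable half exchanges the two rows:
  \<^item> if \<open>i < j\<close>, reading \<open>E\<^sub>j\<close> at its half in column \<open>a\<close> turns the pair \<open>(Y\<^sub>i, E\<^sub>j)\<close> into
    \<open>(Y\<^sub>j, E\<^sub>i)\<close>, and the distance drops from \<open>j - i\<close> to \<open>j - i - 1\<close>;
  \<^item> if \<open>i > j + 1\<close>, reading \<open>E\<^sub>j\<close> at its half in column \<open>b\<close> turns \<open>(Y\<^sub>i, E\<^sub>j)\<close> into
    \<open>(Y\<^bsub>j+1\<^esub>, E\<^bsub>i-1\<^esub>)\<close>, and the distance drops from \<open>i - j - 1\<close> to \<open>i - j - 2\<close>.

  Resolvedness is what lets each step choose the half that it needs.
\<close>

lemma delta_commute: "delta E2 p q = delta E2 q p"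
  by (auto simp: delta_def insert_commute)

text \<open>Both \<open>{p, q}\<close> and a putative \<open>{p, x}\<close> would be edge elements at \<open>p\<close>, and a cell holds at
  most one.\<close>

lemma delta_eq_0_if_other_partner:
  assumes "augmented_configuration m E1 E2" "p \<in> grid m" "{p, q} \<in> E2" "x \<noteq> q"
  shows "delta E2 p x = 0"
proof (rule ccontr)
  assume "delta E2 p x \<noteq> 0"
  then have "p \<noteq> x" "{p, x} \<in> E2"
    by (auto simp: delta_def split: if_splits)
  moreover from this have "{p, x} = {p, q}"
    using assms unfolding augmented_configuration_def edge_elements_def
    by (meson UnI2 insertI1)
  ultimately show False
    using \<open>x \<noteq> q\<close> by auto
qed

lemma resolved_commute: "resolved m E1 E2 p q \<longleftrightarrow> resolved m E1 E2 q p"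
  by (auto simp: resolved_def insert_commute intro: certified.sym)

lemma perp_R_commute: "perp_R m E1 E2 p q \<longleftrightarrow> perp_R m E1 E2 q p"
  by (auto simp: perp_R_def intro: certified.sym)

text \<open>Saturation carries the relation from one half to the other, so a relation obtained at
  whichever half is convenient is one about the representative vector.\<close>

lemma perp_R_edge_if_perp_R_half:
  assumes "resolved m E1 E2 h h'" "perp_R m E1 E2 p h"
  shows "perp_R_edge m E1 E2 p {h, h'}"
proof -
  have "perp_R m E1 E2 h p"
    using assms(2) by (simp only: perp_R_commute)
  then have "perp_R m E1 E2 h' p"
    using assms(1) certified.saturation unfolding resolved_def perp_R_def by blast
  then have "perp_R m E1 E2 p h'"
    by (simp only: perp_R_commute)
  then show ?thesis
    using assms(2) by (simp add: perp_R_edge_def)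
qed

lemma perp_R_line:
  assumes "p \<in> grid m" "q \<in> grid m" "p \<noteq> q" "fst p = fst q \<or> snd p = snd q"
    and "delta E2 p q = 0"
  shows "perp_R m E1 E2 p q"
  using certified.line[OF assms(1-4), of E1 E2] assms(5) by (simp add: perp_R_def)

lemma perp_R_rectangle:
  assumes "perp_R m E1 E2 (r, x) (r', y)"
    and "{r, r'} \<times> {x, y} \<subseteq> grid m" "r \<noteq> r'" "x \<noteq> y"
    and "delta E2 (r, x) (r', y) = 0" "delta E2 (r, y) (r', x) = 0"
  shows "perp_R m E1 E2 (r, y) (r', x)"
  using certified.rectangle[OF assms(2-4), of E1 E2 0] assms(1,5,6) by (simp add: perp_R_def)

theorem lemma4p2:
  fixes m t :: nat and E1 :: "cell set" and E2 :: "cell set set"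
    and s :: "nat \<Rightarrow> nat" and a b c :: nat
  assumes "simple_configuration m E1 E2"
    and "\<forall>i \<le> t + 1. s i \<in> {1..m}"
    and "inj_on s {0..t + 1}"
    and "a \<in> {1..5}" and "b \<in> {1..5}" and "c \<in> {1..5}"
    and "a \<noteq> b" and "a \<noteq> c" and "b \<noteq> c"
    and "\<forall>j \<le> t. resolved m E1 E2 (s j, a) (s (j + 1), b)"
  shows "\<forall>i \<le> t + 1. \<forall>j \<le> t. perp_R_edge m E1 E2 (s i, c) {(s j, a), (s (j + 1), b)}"
proof -
  have config: "augmented_configuration m E1 E2"
    using assms(1) by (simp add: simple_configuration_def)
  have in_grid: "(s i, x) \<in> grid m" if "i \<le> t + 1" "x \<in> {a, b, c}" for i x
    using that assms(2,4-6) by (auto simp: grid_def)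
  have rows_distinct: "s i \<noteq> s k" if "i \<le> t + 1" "k \<le> t + 1" "i \<noteq> k" for i k
    using that assms(3) by (auto simp: inj_on_def)
  have res: "resolved m E1 E2 (s j, a) (s (Suc j), b)" if "j \<le> t" for j
    using that assms(10) by simp
  have edge: "{(s j, a), (s (Suc j), b)} \<in> E2" if "j \<le> t" for j
    using res[OF that] by (simp add: resolved_def)
  have delta_a: "delta E2 (s j, a) (r, c) = 0" if "j \<le> t" for j r
    by (rule delta_eq_0_if_other_partner[OF config in_grid edge[OF that]])
      (use that assms(9) in auto)
  have delta_b: "delta E2 (s (Suc j), b) (r, c) = 0" if "j \<le> t" for j r
    by (rule delta_eq_0_if_other_partner[OF config in_grid, of _ _ "(s j, a)"])
      (use that edge[OF that] assms(8) in \<open>auto simp: insert_commute\<close>)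
  note delta_zero = delta_a delta_b
    delta_commute[THEN trans, OF delta_a] delta_commute[THEN trans, OF delta_b]
  have via_a: "perp_R_edge m E1 E2 p {(s j, a), (s (Suc j), b)}"
    if "j \<le> t" "perp_R m E1 E2 p (s j, a)" for j p
    using perp_R_edge_if_perp_R_half[OF res] that by blast
  have via_b: "perp_R_edge m E1 E2 p {(s j, a), (s (Suc j), b)}"
    if "j \<le> t" "perp_R m E1 E2 p (s (Suc j), b)" for j p
    using perp_R_edge_if_perp_R_half[OF res[THEN resolved_commute[THEN iffD1]]] that
    by (metis insert_commute)
  have "perp_R_edge m E1 E2 (s i, c) {(s j, a), (s (Suc j), b)}"
    if "i \<le> t + 1" "j \<le> t" for i j
    using that
    \<comment> \<open>Of the two truncated differences at most one is nonzero; their sum is the distance from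
        \<open>i\<close> to the set \<open>{j, Suc j}\<close>.\<close>
  proof (induction "(j - i) + (i - Suc j)" arbitrary: i j rule: less_induct)
    case less
    consider "i = j" | "i = Suc j" | "i < j" | "Suc j < i"
      by linarith
    then show ?case
    proof cases
      case 1
      have "perp_R m E1 E2 (s i, c) (s j, a)"
        by (rule perp_R_line)
          (use 1 less.prems in_grid delta_zero assms(8) in auto)
      then show ?thesis
        using via_a less.prems by blast
    next
      case 2
      have "perp_R m E1 E2 (s i, c) (s (Suc j), b)"
        by (rule perp_R_line)
          (use 2 less.prems in_grid delta_zero assms(9) in auto)
      then show ?thesis
        using via_b less.prems by blast
    next
      case 3
      then have "perp_R_edge m E1 E2 (s j, c) {(s i, a), (s (Suc i), b)}"
        using less.prems by (intro less.hyps) auto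
      then have "perp_R m E1 E2 (s i, a) (s j, c)"
        by (simp add: perp_R_edge_def perp_R_commute)
      then have "perp_R m E1 E2 (s i, c) (s j, a)"
        by (rule perp_R_rectangle)
          (use 3 less.prems in_grid rows_distinct delta_zero assms(8) in auto)
      then show ?thesis
        using via_a less.prems by blast
    next
      case 4
      then obtain k where k: "i = Suc k" "j < k" "k \<le> t"
        using less.prems by (cases i) auto
      then have "perp_R_edge m E1 E2 (s (Suc j), c) {(s k, a), (s (Suc k), b)}"
        using less.prems by (intro less.hyps) auto
      then have "perp_R m E1 E2 (s i, b) (s (Suc j), c)"
        using k by (simp add: perp_R_edge_def perp_R_commute)
      then have "perp_R m E1 E2 (s i, c) (s (Suc j), b)"
        by (rule perp_R_rectangle)
          (use k less.prems in_grid rows_distinct delta_zero assms(9) in auto)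
      then show ?thesis
        using via_b less.prems by blast
    qed
  qed
  then show ?thesis
    by simp
qed

end
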